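(* Let $B\ge 2$ and let $g\in\mathbb{Z}[i]$ satisfy $\max\{|\mathrm{Re}(g)|,|\mathrm{Im}(g)|\}\ge B^3$ if $B\ge 7$, and $\max\{|\mathrm{Re}(g)|,|\mathrm{Im}(g)|\}\ge B^4$ if $2\le B\le 6$. Then $|S_B(g)|<|g|$.
   Context: Fix an integer $B\ge 2$. Every nonzero Gaussian integer $a+bi$ is written uniquely as $a+bi=\sum_{j=0}^n (a_j+b_ji)B^j$ with $a_j,b_j\in\mathbb{Z}$, $a_n,b_n$ not both $0$, and for each $j$: $|a_j|\le B-1$, $|b_j|\le B-1$, $\operatorname{sgn}(a)a_j\ge 0$, $\operatorname{sgn}(b)b_j\ge 0$. The Gaussian $B$-happy function $S_B:\mathbb{Z}[i]\to\mathbb{Z}[i]$ is defined by $S_B(0)=0$ and $S_B(a+bi)=\sum_{j=0}^n (a_j+b_ji)^2$. Here $|\cdot|$ is the complex absolute value. *)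

theory Defs
  imports Complex_Main
begin

text \<open>Gaussian integers are represented as the subset \<open>\<int>[i]\<close> of the complex numbers.\<close>

definition gaussian_ints :: "complex set" where
  "gaussian_ints = {z. Re z \<in> \<int> \<and> Im z \<in> \<int>}"

text \<open>The list \<open>ds = [d\<^sub>0, \<dots>, d\<^sub>n]\<close> has the least significant digit first;
  the digit \<open>d\<^sub>j\<close> stands for \<open>a\<^sub>j + b\<^sub>j i\<close>.\<close>

definition is_gaussian_expansion :: "int \<Rightarrow> complex \<Rightarrow> complex list \<Rightarrow> bool" where
  "is_gaussian_expansion B g ds \<longleftrightarrow>
     ds \<noteq> [] \<and> last ds \<noteq> 0 \<and> set ds \<subseteq> gaussian_ints \<and>
     g = (\<Sum>j<length ds. ds ! j * of_int B ^ j) \<and>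
     (\<forall>d\<in>set ds. \<bar>Re d\<bar> \<le> of_int B - 1 \<and> \<bar>Im d\<bar> \<le> of_int B - 1 \<and>
                  sgn (Re g) * Re d \<ge> 0 \<and> sgn (Im g) * Im d \<ge> 0)"

text \<open>The argument is meant to range over \<^const>\<open>gaussian_ints\<close>, where the description operator
  is justified by \<open>ex1_gaussian_expansion\<close> below.\<close>

definition gaussian_happy :: "int \<Rightarrow> complex \<Rightarrow> complex" where
  "gaussian_happy B g =
     (if g = 0 then 0 else (\<Sum>d\<leftarrow>(THE ds. is_gaussian_expansion B g ds). d\<^sup>2))"

lemma digit_sum_eq_0:
  fixes c :: "nat \<Rightarrow> int"
  assumes "\<And>j. j < n \<Longrightarrow> \<bar>c j\<bar> \<le> B - 1" and "(\<Sum>j<n. c j * B ^ j) = 0" and "B \<ge> 2"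
  shows "\<forall>j<n. c j = 0"
  using assms(1,2)
proof (induction n arbitrary: c)
  case (Suc n)
  have s: "c 0 + B * (\<Sum>j<n. c (Suc j) * B ^ j) = 0"
    using Suc.prems(2) unfolding sum.lessThan_Suc_shift
    by (simp add: sum_distrib_left mult_ac)
  then have "B dvd c 0"
    by (metis add.commute dvd_0_right dvd_add_right_iff dvd_triv_left)
  moreover have "\<bar>c 0\<bar> < B" using Suc.prems(1)[of 0] by simp
  ultimately have c0: "c 0 = 0"
    using zdvd_not_zless[of "\<bar>c 0\<bar>" B] by fastforce
  then have "(\<Sum>j<n. c (Suc j) * B ^ j) = 0" using s assms(3) by simp
  then have "\<forall>j<n. c (Suc j) = 0"
    by (rule Suc.IH[rotated]) (rule Suc.prems(1), rule Suc_mono)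
  then show ?case using c0 by (metis less_Suc_eq_0_disj)
qed simp

lemma real_digits_unique:
  fixes c c' :: "nat \<Rightarrow> real"
  assumes B: "B \<ge> 2" and i: "\<And>j. c j \<in> \<int>" "\<And>j. c' j \<in> \<int>"
    and a: "\<And>j. \<bar>c j\<bar> \<le> of_int B - 1" "\<And>j. \<bar>c' j\<bar> \<le> of_int B - 1"
    and s: "\<And>j. sgn x * c j \<ge> 0" "\<And>j. sgn x * c' j \<ge> 0"
    and x: "x = (\<Sum>j<n. c j * of_int B ^ j)" "x = (\<Sum>j<n. c' j * of_int B ^ j)"
    and j: "j < n"
  shows "c j = c' j"
proof -
  have z: "\<forall>j<n. e j = 0"
    if e: "\<And>j. e j \<in> \<int>" "\<And>j. \<bar>e j\<bar> \<le> of_int B - 1" "(\<Sum>j<n. e j * of_int B ^ j) = 0"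
    for e :: "nat \<Rightarrow> real"
  proof -
    have f: "e j = of_int \<lfloor>e j\<rfloor>" for j using e(1)[of j] by (simp add: of_int_floor)
    have "real_of_int (\<Sum>j<n. \<lfloor>e j\<rfloor> * B ^ j) = (\<Sum>j<n. e j * of_int B ^ j)"
      using f by simp
    then have "(\<Sum>j<n. \<lfloor>e j\<rfloor> * B ^ j) = 0" using e(3) by (metis of_int_eq_0_iff)
    moreover have "\<bar>\<lfloor>e j\<rfloor>\<bar> \<le> B - 1" for j
    proof -
      have "real_of_int \<bar>\<lfloor>e j\<rfloor>\<bar> \<le> of_int (B - 1)" using e(2)[of j] f[of j] by simp
      then show ?thesis by linarith
    qed
    ultimately have "\<forall>j<n. \<lfloor>e j\<rfloor> = 0" using B
      by (intro digit_sum_eq_0[of n "\<lambda>j. \<lfloor>e j\<rfloor>" B])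
    then show ?thesis using f by (metis of_int_0)
  qed
  show ?thesis
  proof (cases "x = 0")
    case True
    have "c j = 0" using z[OF i(1) a(1) x(1)[symmetric, unfolded True]] j by blast
    moreover have "c' j = 0" using z[OF i(2) a(2) x(2)[symmetric, unfolded True]] j by blast
    ultimately show ?thesis by simp
  next
    case False
    have b: "\<bar>c j - c' j\<bar> \<le> of_int B - 1" for j
      using a[of j] s[of j] False by (auto simp: sgn_if split: if_splits)
    have "(\<Sum>j<n. (c j - c' j) * of_int B ^ j) = 0"
      unfolding left_diff_distrib sum_subtractf x(1)[symmetric] x(2)[symmetric] by simp
    with Ints_diff[OF i] b have "\<forall>j<n. c j - c' j = 0"
      by (intro z[of "\<lambda>j. c j - c' j"])
    then show ?thesis using j by simp
  qed
qed

lemma gaussian_expansion_unique: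
  assumes B: "B \<ge> 2" and d: "is_gaussian_expansion B g ds" and e: "is_gaussian_expansion B g es"
  shows "ds = es"
proof -
  define n where "n = max (length ds) (length es)"
  define p where "p = (\<lambda>(xs::complex list) j. if j < length xs then xs ! j else 0)"
  have s: "g = (\<Sum>j<n. p xs j * of_int B ^ j)"
    if "is_gaussian_expansion B g xs" "length xs \<le> n" for xs
  proof -
    have "g = (\<Sum>j<length xs. p xs j * of_int B ^ j)"
      using that(1) by (simp add: is_gaussian_expansion_def p_def)
    also have "\<dots> = (\<Sum>j<n. p xs j * of_int B ^ j)"
      using that(2) by (intro sum.mono_neutral_left) (auto simp: p_def)
    finally show ?thesis .
  qed
  have pow: "of_int B ^ j = complex_of_real (of_int B ^ j)" for j by simp
  have sR: "Re g = (\<Sum>j<n. Re (p xs j) * of_int B ^ j)"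
   and sI: "Im g = (\<Sum>j<n. Im (p xs j) * of_int B ^ j)"
    if "is_gaussian_expansion B g xs" "length xs \<le> n" for xs
    by (subst s[OF that], simp only: pow Re_sum Im_sum Re_complex_of_real Im_complex_of_real
          times_complex.sel, simp)+
  have b: "Re (p xs j) \<in> \<int>" "Im (p xs j) \<in> \<int>"
     "\<bar>Re (p xs j)\<bar> \<le> of_int B - 1" "\<bar>Im (p xs j)\<bar> \<le> of_int B - 1"
     "sgn (Re g) * Re (p xs j) \<ge> 0" "sgn (Im g) * Im (p xs j) \<ge> 0"
    if "is_gaussian_expansion B g xs" for xs j
    using that B nth_mem[of j xs]
    by (fastforce simp: is_gaussian_expansion_def p_def gaussian_ints_def)+
  have le: "length ds \<le> n" "length es \<le> n" by (auto simp: n_def)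
  have eq: "p ds j = p es j" if "j < n" for j
  proof (rule complex_eqI)
    show "Re (p ds j) = Re (p es j)"
      by (rule real_digits_unique[OF B b(1)[OF d] b(1)[OF e] b(3)[OF d] b(3)[OF e]
            b(5)[OF d] b(5)[OF e] sR[OF d le(1)] sR[OF e le(2)] that])
    show "Im (p ds j) = Im (p es j)"
      by (rule real_digits_unique[OF B b(2)[OF d] b(2)[OF e] b(4)[OF d] b(4)[OF e]
            b(6)[OF d] b(6)[OF e] sI[OF d le(1)] sI[OF e le(2)] that])
  qed
  have ln: "p xs (length xs - 1) \<noteq> 0" "length xs > 0" if "is_gaussian_expansion B g xs" for xs
    using that by (auto simp: is_gaussian_expansion_def p_def last_conv_nth)
  have l: "length ds = length es"
  proof (rule linorder_cases[of "length ds" "length es"])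
    assume "length ds < length es"
    then show ?thesis using eq[of "length es - 1"] ln[OF e] by (auto simp: p_def n_def split: if_splits)
  next
    assume "length ds > length es"
    then show ?thesis using eq[of "length ds - 1"] ln[OF d] by (auto simp: p_def n_def split: if_splits)
  qed
  show ?thesis
    using eq l by (intro nth_equalityI) (auto simp: p_def n_def)
qed

lemma digit_sum_mod:
  fixes B m :: int
  assumes "B \<ge> 2" "m \<ge> 0"
  shows "(\<Sum>j<n. (m div B ^ j) mod B * B ^ j) = m mod B ^ n"
proof (induction n)
  case (Suc n)
  have "m mod (B ^ n * B) = B ^ n * (m div B ^ n mod B) + m mod B ^ n"
    using assms by (intro zmod_zmult2_eq) simp
  then show ?case using Suc by (simp add: mult_ac)
qed simp

lemma gaussian_expansion_exists:
  assumes B: "B \<ge> 2" and g: "g \<in> gaussian_ints" "g \<noteq> 0"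
  shows "\<exists>ds. is_gaussian_expansion B g ds"
proof -
  obtain a b where ab: "Re g = of_int a" "Im g = of_int b"
    using g(1) by (auto simp: gaussian_ints_def elim!: Ints_cases)
  define M where "M = max \<bar>a\<bar> \<bar>b\<bar>"
  have M: "M > 0" using g(2) ab by (auto simp: M_def complex_eq_iff)
  have "\<exists>k. M < B ^ k"
  proof
    have "M = int (nat M)" using M by simp
    also have "\<dots> < 2 ^ nat M"
      by (metis of_nat_less_two_power)
    also have "\<dots> \<le> B ^ nat M" using B by (intro power_mono) auto
    finally show "M < B ^ nat M" .
  qed
  then have "M < B ^ (LEAST k. M < B ^ k)" by (rule LeastI_ex)
  then obtain n where n: "M < B ^ Suc n" "\<not> M < B ^ n"
    using M not_less_Least[of _ "\<lambda>k. M < B ^ k"]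
    by (cases "LEAST k. M < B ^ k") auto
  define dig where "dig = (\<lambda>(x::int) j. sgn x * ((\<bar>x\<bar> div B ^ j) mod B))"
  define f where "f = (\<lambda>j. Complex (of_int (dig a j)) (of_int (dig b j)))"
  define ds where "ds = map f [0..<Suc n]"
  have sum: "(\<Sum>j<Suc n. dig x j * B ^ j) = x" if "\<bar>x\<bar> \<le> M" for x
  proof -
    have "(\<Sum>j<Suc n. dig x j * B ^ j) = sgn x * (\<Sum>j<Suc n. (\<bar>x\<bar> div B ^ j) mod B * B ^ j)"
      by (simp only: dig_def sum_distrib_left mult.assoc)
    also have "\<dots> = sgn x * (\<bar>x\<bar> mod B ^ Suc n)" using digit_sum_mod[OF B, of "\<bar>x\<bar>" "Suc n"] by simp
    also have "\<dots> = x" using that n(1) by (simp add: sgn_mult_abs del: power_Suc)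
    finally show ?thesis .
  qed
  have bd: "\<bar>dig x j\<bar> \<le> B - 1" "sgn x * dig x j \<ge> 0" for x j
    using B pos_mod_bound[of B "\<bar>x\<bar> div B ^ j"] pos_mod_sign[of B "\<bar>x\<bar> div B ^ j"]
    by (auto simp: dig_def abs_mult sgn_if)
  have nz: "dig x n \<noteq> 0" if "\<bar>x\<bar> = M" for x
  proof -
    have "\<bar>x\<bar> div B ^ n > 0" using n(2) that B by (simp add: pos_imp_zdiv_pos_iff)
    moreover have "\<bar>x\<bar> div B ^ n < B"
    proof -
      have "B ^ n * (\<bar>x\<bar> div B ^ n) \<le> \<bar>x\<bar>" using B
        by (metis mult_div_mod_eq le_add_same_cancel1 pos_mod_sign zero_less_power
            zero_less_numeral less_le_trans)
      then have "B ^ n * (\<bar>x\<bar> div B ^ n) < B ^ n * B" using n(1) that by (simp add: mult_ac)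
      then show ?thesis using B by simp
    qed
    ultimately show ?thesis using M that by (auto simp: dig_def sgn_if)
  qed
  have "last ds \<noteq> 0"
  proof -
    have "\<bar>a\<bar> = M \<or> \<bar>b\<bar> = M" by (simp add: M_def max_def)
    then have "dig a n \<noteq> 0 \<or> dig b n \<noteq> 0" using nz by blast
    then show ?thesis by (auto simp: ds_def f_def complex_eq_iff)
  qed
  moreover have "set ds \<subseteq> gaussian_ints" by (auto simp: ds_def f_def gaussian_ints_def)
  moreover have "g = (\<Sum>j<length ds. ds ! j * of_int B ^ j)"
  proof -
    have pow: "of_int B ^ j = complex_of_real (of_int B ^ j)" for j by simp
    have "(\<Sum>j<length ds. ds ! j * of_int B ^ j) = (\<Sum>j<Suc n. f j * of_int B ^ j)"
      by (intro sum.cong) (simp_all add: ds_def nth_append del: upt_Suc)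
    also have "\<dots> = g"
    proof (rule complex_eqI)
      have "Re (\<Sum>j<Suc n. f j * of_int B ^ j) = of_int (\<Sum>j<Suc n. dig a j * B ^ j)"
        by (simp only: pow Re_sum Re_complex_of_real Im_complex_of_real times_complex.sel f_def
            complex.sel) simp
      then show "Re (\<Sum>j<Suc n. f j * of_int B ^ j) = Re g"
        using sum[of a] ab by (simp add: M_def del: sum.lessThan_Suc)
      have "Im (\<Sum>j<Suc n. f j * of_int B ^ j) = of_int (\<Sum>j<Suc n. dig b j * B ^ j)"
        by (simp only: pow Im_sum Re_complex_of_real Im_complex_of_real times_complex.sel f_def
            complex.sel) simp
      then show "Im (\<Sum>j<Suc n. f j * of_int B ^ j) = Im g"
        using sum[of b] ab by (simp add: M_def del: sum.lessThan_Suc)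
    qed
    finally show ?thesis by simp
  qed
  moreover have "\<bar>Re d\<bar> \<le> of_int B - 1 \<and> \<bar>Im d\<bar> \<le> of_int B - 1 \<and>
      sgn (Re g) * Re d \<ge> 0 \<and> sgn (Im g) * Im d \<ge> 0" if d: "d \<in> set ds" for d
  proof -
    obtain j where j: "d = f j" using d unfolding ds_def set_map by blast
    have r: "\<bar>real_of_int (dig x j)\<bar> \<le> of_int B - 1" "sgn (real_of_int x) * dig x j \<ge> 0" for x
    proof -
      have "real_of_int \<bar>dig x j\<bar> \<le> real_of_int (B - 1)" using bd(1) of_int_le_iff by blast
      then show "\<bar>real_of_int (dig x j)\<bar> \<le> of_int B - 1" by simp
      have "real_of_int (sgn x * dig x j) \<ge> 0" using bd(2) of_int_0_le_iff by blast
      then show "sgn (real_of_int x) * dig x j \<ge> 0" by (simp add: sgn_if split: if_splits)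
    qed
    show ?thesis using r ab by (simp add: j f_def)
  qed
  ultimately have "is_gaussian_expansion B g ds"
    unfolding is_gaussian_expansion_def by (auto simp: ds_def)
  then show ?thesis ..
qed

lemma ex1_gaussian_expansion:
  assumes "B \<ge> 2" "g \<in> gaussian_ints" "g \<noteq> 0"
  shows "\<exists>!ds. is_gaussian_expansion B g ds"
  using gaussian_expansion_exists[OF assms] gaussian_expansion_unique[OF assms(1)] by blast

end

theory Submission
  imports Defs
begin

text \<open>If \<open>g\<close> has digits \<open>d\<^sub>0, \<dots>, d\<^sub>n\<close>, then each \<open>d\<^sub>j\<^sup>2\<close> has absolute value at most \<open>2 (B - 1)\<^sup>2\<close>,
  so \<open>\<bar>S\<^sub>B(g)\<bar> \<le> 2 (n + 1) (B - 1)\<^sup>2\<close>. On the other hand \<open>\<bar>g\<bar> \<ge> B\<^sup>n\<close>, because the leading digit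
  is nonzero and the digits of each component do not cancel. The size hypothesis on \<open>g\<close> forces
  \<open>n \<ge> 3\<close> (resp. \<open>n \<ge> 4\<close>), from where on \<open>2 (n + 1) (B - 1)\<^sup>2 < B\<^sup>n\<close>.\<close>

text \<open>The extreme case has every digit equal to \<open>b - 1\<close>, where the geometric
  series gives \<open>b ^ n - 1\<close>.\<close>

lemma abs_digit_sum_less:
  fixes c :: "nat \<Rightarrow> real" and b :: real
  assumes "b \<ge> 1" and "\<And>j. j < n \<Longrightarrow> \<bar>c j\<bar> \<le> b - 1"
  shows "\<bar>\<Sum>j<n. c j * b ^ j\<bar> < b ^ n"
proof -
  have "\<bar>\<Sum>j<n. c j * b ^ j\<bar> \<le> (\<Sum>j<n. \<bar>c j * b ^ j\<bar>)" by (rule sum_abs)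
  also have "\<dots> \<le> (\<Sum>j<n. (b - 1) * b ^ j)"
    using assms by (intro sum_mono) (auto simp: abs_mult intro!: mult_right_mono)
  also have "\<dots> = b ^ n - 1" by (simp add: power_diff_1_eq sum_distrib_left)
  finally show ?thesis by simp
qed

text \<open>Multiplying by \<open>sgn x\<close> makes every term nonnegative, so the leading term
  alone bounds the sum from below; its digit is a nonzero integer, hence at least 1 in absolute
  value.\<close>

lemma abs_digit_sum_ge:
  fixes c :: "nat \<Rightarrow> real" and b :: real
  assumes b: "b \<ge> 1" and a: "\<And>j. j \<le> n \<Longrightarrow> \<bar>c j\<bar> \<le> b - 1"
    and s: "\<And>j. j \<le> n \<Longrightarrow> sgn x * c j \<ge> 0"
    and x: "x = (\<Sum>j<Suc n. c j * b ^ j)"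
    and lead: "c n \<in> \<int>" "c n \<noteq> 0"
  shows "\<bar>x\<bar> \<ge> b ^ n"
proof -
  have c1: "\<bar>c n\<bar> \<ge> 1" using lead by (metis Ints_nonzero_abs_ge1)
  then have cb: "\<bar>c n * b ^ n\<bar> \<ge> b ^ n" using b by (simp add: abs_mult)
  \<comment> \<open>If \<open>x\<close> were 0, then \<open>sgn x\<close> would be 0 and the sign
    condition on the digits would be empty. The lower terms add up to less than \<open>b ^ n\<close>
    in absolute value, so they cannot cancel the leading term.\<close>
  have "x \<noteq> 0"
    using abs_digit_sum_less[of b n c] a b cb x by auto
  then have "\<bar>sgn x * c n\<bar> = \<bar>c n\<bar>" by (simp add: abs_mult)
  then have "sgn x * c n \<ge> 1" using c1 s[of n] by linarith
  then have "b ^ n \<le> sgn x * c n * b ^ n" using b by simp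
  also have "\<dots> \<le> (\<Sum>j<Suc n. sgn x * c j * b ^ j)"
    using b s by (auto intro!: sum_nonneg)
  also have "\<dots> = sgn x * (\<Sum>j<Suc n. c j * b ^ j)"
    by (simp only: sum_distrib_left mult.assoc)
  also have "\<dots> = sgn x * x" by (simp only: x[symmetric])
  finally show ?thesis by (simp add: abs_sgn mult.commute)
qed

text \<open>Passing from \<open>n\<close> to \<open>Suc n\<close> at most doubles the left side and
  multiplies the right side by \<open>b \<ge> 2\<close>.\<close>

lemma linear_less_power_mono:
  fixes b C :: real
  assumes "b \<ge> 2" "C \<ge> 0" "real (Suc k) * C < b ^ k" "k \<le> n"
  shows "real (Suc n) * C < b ^ n"
  using assms(4)
proof (induction n rule: dec_induct)
  case (step n)
  have "real (Suc (Suc n)) * C \<le> 2 * (real (Suc n) * C)"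
    using assms(2) by (simp add: algebra_simps)
  also have "\<dots> < 2 * b ^ n" using step.IH by simp
  also have "\<dots> \<le> b ^ Suc n" using assms(1) by simp
  finally show ?case .
qed (rule assms(3))

lemma norm_sum_list_squares_le:
  fixes ds :: "complex list"
  assumes "\<And>d. d \<in> set ds \<Longrightarrow> (cmod d)\<^sup>2 \<le> C"
  shows "cmod (\<Sum>d\<leftarrow>ds. d\<^sup>2) \<le> real (length ds) * C"
  using assms
proof (induction ds)
  case (Cons d ds)
  have "cmod (\<Sum>d\<leftarrow>d # ds. d\<^sup>2) \<le> (cmod d)\<^sup>2 + cmod (\<Sum>d\<leftarrow>ds. d\<^sup>2)"
    using norm_triangle_ineq[of "d\<^sup>2"] by (simp add: norm_power)
  also have "\<dots> \<le> C + real (length ds) * C"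
    using Cons by (intro add_mono) auto
  finally show ?case by (simp add: algebra_simps)
qed simp

lemma gaussian_expansion_components:
  assumes "is_gaussian_expansion B g ds"
  shows "Re g = (\<Sum>j<length ds. Re (ds ! j) * of_int B ^ j)"
    and "Im g = (\<Sum>j<length ds. Im (ds ! j) * of_int B ^ j)"
proof -
  \<comment> \<open>With the powers written as embedded reals, their imaginary parts vanish and the
    products split componentwise.\<close>
  have g: "g = (\<Sum>j<length ds. ds ! j * complex_of_real (of_int B ^ j))"
    using assms by (simp add: is_gaussian_expansion_def)
  show "Re g = (\<Sum>j<length ds. Re (ds ! j) * of_int B ^ j)"
    and "Im g = (\<Sum>j<length ds. Im (ds ! j) * of_int B ^ j)"
    by (subst g, simp only: Re_sum Im_sum Re_complex_of_real Im_complex_of_real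
          times_complex.sel, simp)+
qed

text \<open>Both cases of the theorem are instances, with \<open>k\<close> = 3 and \<open>k\<close>
  = 4. The last hypothesis is the numerical inequality at the smallest possible index of the leading
  digit.\<close>

lemma gaussian_happy_less:
  assumes B: "B \<ge> 2" and g: "g \<in> gaussian_ints"
    and big: "max \<bar>Re g\<bar> \<bar>Im g\<bar> \<ge> of_int B ^ k"
    and k: "real (Suc k) * (2 * (of_int B - 1)\<^sup>2) < of_int B ^ k"
  shows "cmod (gaussian_happy B g) < cmod g"
proof -
  define b where "b = real_of_int B"
  have b: "b \<ge> 2" using B by (simp add: b_def)
  have "b ^ k > 0" using b by simp
  then have g0: "g \<noteq> 0" using big by (auto simp: b_def)
  define ds where "ds = (THE ds. is_gaussian_expansion B g ds)"
  have e: "is_gaussian_expansion B g ds"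
    unfolding ds_def by (rule theI'[OF ex1_gaussian_expansion[OF B g g0]])
  then obtain n where n: "length ds = Suc n"
    by (auto simp: is_gaussian_expansion_def neq_Nil_conv)
  have dig: "Re d \<in> \<int>" "Im d \<in> \<int>" "\<bar>Re d\<bar> \<le> b - 1" "\<bar>Im d\<bar> \<le> b - 1"
      "sgn (Re g) * Re d \<ge> 0" "sgn (Im g) * Im d \<ge> 0" if "d \<in> set ds" for d
    using e that by (auto simp: is_gaussian_expansion_def gaussian_ints_def b_def)
  have mem: "ds ! j \<in> set ds" if "j < Suc n" for j using that n by simp
  note comp = gaussian_expansion_components[OF e, folded b_def, unfolded n]
  have "\<bar>Re g\<bar> < b ^ Suc n" "\<bar>Im g\<bar> < b ^ Suc n"
    unfolding comp by (rule abs_digit_sum_less; use b dig mem in force)+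
  \<comment> \<open>An expansion of length \<open>Suc n\<close> keeps both components below
    \<open>b ^ Suc n\<close>, so a large component forces a long expansion.\<close>
  then have "b ^ k < b ^ Suc n" using big by (auto simp: b_def simp del: power_Suc)
  then have kn: "k \<le> n" using b power_less_imp_less_exp[of b k "Suc n"] by simp
  have "ds ! n \<noteq> 0" using e n by (auto simp: is_gaussian_expansion_def last_conv_nth)
  then have "Re (ds ! n) \<noteq> 0 \<or> Im (ds ! n) \<noteq> 0" by (auto simp: complex_eq_iff)
  \<comment> \<open>One component of the leading digit may be 0, so the lower bound is only
    available for a component where it is not.\<close>
  then have "b ^ n \<le> \<bar>Re g\<bar> \<or> b ^ n \<le> \<bar>Im g\<bar>"
  proof (rule disj_forward)
    show "b ^ n \<le> \<bar>Re g\<bar>" if "Re (ds ! n) \<noteq> 0"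
      by (rule abs_digit_sum_ge[OF _ _ _ comp(1) _ that]) (use b dig mem in auto)
    show "b ^ n \<le> \<bar>Im g\<bar>" if "Im (ds ! n) \<noteq> 0"
      by (rule abs_digit_sum_ge[OF _ _ _ comp(2) _ that]) (use b dig mem in auto)
  qed
  then have ge: "b ^ n \<le> cmod g"
    using abs_Re_le_cmod[of g] abs_Im_le_cmod[of g] by linarith
  have "(cmod d)\<^sup>2 \<le> 2 * (b - 1)\<^sup>2" if "d \<in> set ds" for d
  proof -
    have "(Re d)\<^sup>2 \<le> (b - 1)\<^sup>2" "(Im d)\<^sup>2 \<le> (b - 1)\<^sup>2"
      using dig[OF that] b by (auto simp flip: abs_le_square_iff)
    then show ?thesis by (simp add: cmod_power2)
  qed
  then have "cmod (\<Sum>d\<leftarrow>ds. d\<^sup>2) \<le> real (Suc n) * (2 * (b - 1)\<^sup>2)"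
    using norm_sum_list_squares_le n by metis
  also have "\<dots> < b ^ n"
    by (rule linear_less_power_mono[OF b _ k[folded b_def] kn]) simp
  finally show ?thesis using ge g0 by (simp add: gaussian_happy_def ds_def)
qed

theorem theorem4:
  fixes B :: int and g :: complex
  assumes "B \<ge> 2"
    and "g \<in> gaussian_ints"
    and "B \<ge> 7 \<Longrightarrow> max \<bar>Re g\<bar> \<bar>Im g\<bar> \<ge> of_int B ^ 3"
    and "B \<le> 6 \<Longrightarrow> max \<bar>Re g\<bar> \<bar>Im g\<bar> \<ge> of_int B ^ 4"
  shows "cmod (gaussian_happy B g) < cmod g"
proof (cases "B \<ge> 7")
  case True
  \<comment> \<open>The factor 8 is \<open>2 * (k + 1)\<close> for \<open>k\<close> = 3. For
    \<open>B\<close> = 7 the inequality reads 288 < 343; from \<open>B\<close> = 8 on, the factor is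
    at most \<open>B\<close>.\<close>
  have "8 * (B - 1)\<^sup>2 < B ^ 3"
  proof (cases "B = 7")
    case False
    then have "8 * (B - 1)\<^sup>2 \<le> B * (B - 1)\<^sup>2" using True by (intro mult_right_mono) auto
    also have "\<dots> < B * B\<^sup>2" using True by (intro mult_strict_left_mono power_strict_mono) auto
    finally show ?thesis by (simp add: power3_eq_cube power2_eq_square)
  qed simp
  then have "real_of_int (8 * (B - 1)\<^sup>2) < of_int (B ^ 3)" by (simp only: of_int_less_iff)
  then show ?thesis
    using assms True by (intro gaussian_happy_less[of B g 3]) auto
next
  case False
  then have "B \<in> {2, 3, 4, 5, 6}" using assms(1) by auto
  \<comment> \<open>The factor 10 is \<open>2 * (k + 1)\<close> for \<open>k\<close> = 4; the five
    bases are checked one by one.\<close>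
  then have "10 * (B - 1)\<^sup>2 < B ^ 4" by auto
  then have "real_of_int (10 * (B - 1)\<^sup>2) < of_int (B ^ 4)" by (simp only: of_int_less_iff)
  then show ?thesis
    using assms False by (intro gaussian_happy_less[of B g 4]) auto
qed

end
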